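(* Let $k$ be an algebraically closed field of characteristic $2$. Then the group algebra $k(C_2\times C_2)$ of the Klein four-group has exactly one block, namely $k(C_2\times C_2)$ itself.
   Context: For a finite-dimensional algebra $A$, write $1=e_1+\cdots+e_n$ as the (unique) sum of primitive central orthogonal idempotents; the blocks of $A$ are the two-sided ideals $Ae_1,\dots,Ae_n$, i.e. the indecomposable two-sided ideal direct summands of $A$. *)

theory Defs
  imports
    "HOL-Library.Poly_Mapping"
    "HOL-Library.Z2"
    "HOL-Library.Product_Plus"
    "HOL-Computational_Algebra.Computational_Algebra"
begin

text \<open>
  Groups are written additively (class \<open>group_add\<close>), so the convolution product of
  \<open>Poly_Mapping\<close> is the multiplication of the group algebra.  Finite support is no
  restriction for a finite group.
\<close>

type_synonym ('k, 'g) group_algebra = "'g \<Rightarrow>\<^sub>0 'k"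

text \<open>\<open>bit\<close> is the field with two elements; its additive group is cyclic of order 2.\<close>

type_synonym klein_four = "bit \<times> bit"

definition central_idempotent :: "'a::ring_1 \<Rightarrow> bool" where
  "central_idempotent e \<longleftrightarrow> e * e = e \<and> (\<forall>x. e * x = x * e)"

definition primitive_central_idempotent :: "'a::ring_1 \<Rightarrow> bool" where
  "primitive_central_idempotent e \<longleftrightarrow>
     central_idempotent e \<and> e \<noteq> 0 \<and>
     \<not> (\<exists>f g. central_idempotent f \<and> central_idempotent g \<and> f \<noteq> 0 \<and> g \<noteq> 0 \<and>
             f * g = 0 \<and> e = f + g)"

definition block_decomposition :: "'a::ring_1 set \<Rightarrow> bool" where
  "block_decomposition E \<longleftrightarrow>
     finite E \<and> (\<forall>e\<in>E. primitive_central_idempotent e) \<and>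
     (\<forall>e\<in>E. \<forall>f\<in>E. e \<noteq> f \<longrightarrow> e * f = 0) \<and> (\<Sum>e\<in>E. e) = 1"

text \<open>
  A block depends only on the ring structure of the algebra.  Here the algebra is a whole type,
  so the algebra as a block of itself is \<open>UNIV\<close>.  As \<open>block_decomposition E\<close>
  determines \<open>E\<close>, the union over all such \<open>E\<close> involves at most one
  set of idempotents; it is empty if \<open>1\<close> has no such decomposition.
\<close>

definition blocks :: "'a::ring_1 set set" where
  "blocks = {range (\<lambda>a. a * e) | e E. block_decomposition E \<and> e \<in> E}"

end

theory Submission
  imports Defs
begin

text \<open>
  Blocks correspond to primitive central idempotents, so a ring is its own only block as soon
  as \<open>0\<close> and \<open>1\<close> are its only central idempotents
  (lemma \<open>blocks_eq_UNIV_if_connected\<close>).  For the Klein four-group in characteristic 2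
  this condition comes from squaring: the mixed terms of \<open>(x + y)\<^sup>2\<close> cancel because
  \<open>2 = 0\<close>, and the squares of group elements are trivial because the group has exponent
  2.  Hence every square is a scalar multiple of the identity (lemma \<open>square_is_scalar\<close>).
  An idempotent is its own square, so it is a scalar, and an idempotent scalar
  is \<open>0\<close> or \<open>1\<close>.
\<close>

text \<open>
  If \<open>0\<close> and \<open>1\<close> are the only candidates, no splitting
  \<open>1 = f + g\<close> into nonzero orthogonal central idempotents exists, since \<open>f = g = 1\<close>
  would give \<open>f * g = 1\<close>; so \<open>{1}\<close> is the only block decomposition.
\<close>

lemma blocks_eq_UNIV_if_connected:
  assumes connected: "\<And>e :: 'a::ring_1. central_idempotent e \<Longrightarrow> e = 0 \<or> e = 1"
  shows "(blocks :: 'a set set) = {UNIV}"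
proof -
  have primitive_one: "primitive_central_idempotent (1 :: 'a)"
    unfolding primitive_central_idempotent_def
  proof (intro conjI notI)
    show "central_idempotent (1 :: 'a)"
      by (simp add: central_idempotent_def)
    show False if "(1 :: 'a) = 0"
      using that by simp
    show False if "\<exists>f g :: 'a. central_idempotent f \<and> central_idempotent g \<and>
      f \<noteq> 0 \<and> g \<noteq> 0 \<and> f * g = 0 \<and> 1 = f + g"
      using that connected by (metis mult_1_left)
  qed
  have primitive_eq_one: "e = 1" if "primitive_central_idempotent e" for e :: 'a
    using that connected unfolding primitive_central_idempotent_def by blast
  have decomposition_one: "block_decomposition {1 :: 'a}"
    using primitive_one by (simp add: block_decomposition_def)
  have element_eq_one: "e = 1" if "block_decomposition E" "e \<in> E" for e :: 'a and E
    using that primitive_eq_one by (auto simp: block_decomposition_def)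
  have "X = UNIV" if "X \<in> blocks" for X :: "'a set"
  proof -
    obtain e E where X: "X = range (\<lambda>a. a * e)" and "block_decomposition E" "e \<in> E"
      using \<open>X \<in> blocks\<close> unfolding blocks_def by blast
    then have "e = 1"
      by (intro element_eq_one)
    with X show ?thesis by simp
  qed
  moreover have "range (\<lambda>a. a * (1 :: 'a)) \<in> blocks"
    unfolding blocks_def using decomposition_one by blast
  ultimately show ?thesis by auto
qed

text \<open>
  Adding one monomial \<open>y\<close> at a time to \<open>f\<close>: the square of \<open>f + y\<close> is
  \<open>f * f + y * y\<close> in characteristic 2, and \<open>y * y\<close> sits over
  \<open>g + g = 0\<close>.
\<close>

lemma square_is_scalar:
  fixes x :: "('k::comm_ring_1, 'g::ab_group_add) group_algebra"
  assumes char2: "CHAR('k) = 2" and exponent2: "\<And>g :: 'g. g + g = 0"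
  shows "\<exists>c. x * x = Poly_Mapping.single 0 c"
proof -
  have "(2 :: 'k) = 0"
    using of_nat_CHAR[where ?'a = 'k] by (simp add: char2)
  then have double: "a + a = 0" for a :: 'k
    by (metis mult_2 mult_zero_left)
  have double': "y + y = 0" for y :: "('k, 'g) group_algebra"
    by (rule poly_mapping_eqI) (simp only: lookup_add lookup_zero double)
  show ?thesis
  proof (induction x rule: update_induct)
    case const
    show ?case by (auto intro: exI[of _ 0])
  next
    case (update f g a)
    then obtain c where c: "f * f = Poly_Mapping.single 0 c"
      by blast
    let ?y = "Poly_Mapping.single g a"
    have "Poly_Mapping.update g a f = f + ?y"
      using update.hyps
      by (intro poly_mapping_eqI)
        (auto simp: lookup_update lookup_add lookup_single when_def in_keys_iff)
    moreover have "(f + ?y) * (f + ?y) = f * f + ?y * ?y + (f * ?y + f * ?y)"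
      by (simp only: distrib_left distrib_right mult.commute[of ?y f] ac_simps)
    moreover have "?y * ?y = Poly_Mapping.single 0 (a * a)"
      by (simp add: mult_single exponent2)
    ultimately show ?case
      by (metis c double' add_0_right single_add)
  qed
qed

lemma idempotent_eq_0_or_1:
  fixes e :: "('k::idom, 'g::ab_group_add) group_algebra"
  assumes "CHAR('k) = 2" "\<And>g :: 'g. g + g = 0" and idem: "e * e = e"
  shows "e = 0 \<or> e = 1"
proof -
  obtain c where c: "e = Poly_Mapping.single 0 c"
    using square_is_scalar[of e] assms by metis
  from idem have "Poly_Mapping.single (0 :: 'g) (c * c) = Poly_Mapping.single 0 c"
    by (simp add: c mult_single)
  then have "c * c = c"
    by (metis lookup_single_eq)
  then have "c = 0 \<or> c = 1"
    by simp
  with c show ?thesis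
    by auto
qed

theorem mainTheorem10:
  assumes "CHAR('k::alg_closed_field) = 2"
  shows "(blocks :: ('k, klein_four) group_algebra set set) = {UNIV}"
proof (rule blocks_eq_UNIV_if_connected)
  fix e :: "('k, klein_four) group_algebra"
  assume "central_idempotent e"
  then have "e * e = e"
    by (simp add: central_idempotent_def)
  moreover have "g + g = 0" for g :: klein_four
    by (cases g) (simp add: zero_prod_def)
  ultimately show "e = 0 \<or> e = 1"
    by (intro idempotent_eq_0_or_1[OF assms])
qed

end
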